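(* Let $M$ be a preordered set and let $H$ be the free semilattice over $M$. Then for every minimal semilattice $S$ over $M$ there is a semilattice homomorphism $\sim$ from $H$ onto $S$ with $a\sim a$ for all $a\in M$.
   Context: A preordered set: set with reflexive transitive $\le$; $a\equiv b$ iff $a\le b$ and $b\le a$. A semilattice: preordered set in which any $a,b$ have a greatest lower bound, unique up to $\equiv$, denoted $a\wedge b$. $M$ is a part of $H$ if $M\subseteq H$ and the preorder of $M$ is the restriction of that of $H$; a semilattice $H$ with $M$ a part of it is a semilattice over $M$. It is minimal over $M$ if no proper subset $H_0\subsetneq H$ contains $M$ and is closed under taking meets (i.e. $a,b\in H_0$, $c\equiv a\wedge b$ imply $c\in H_0$). The free semilattice over $M$ is the minimal semilattice $H$ over $M$ (unique up to isomorphism over $M$) such that for all $a_1,\dots,a_n,b\in M$: $a_1\wedge\dots\wedge a_n\le b$ in $H$ iff $a_i\le b$ for some $i$. A homomorphism from a preordered set $A$ into a preordered set $A'$ is a relation $\sim\subseteq A\times A'$ such that every $a\in A$ has some $a'$ with $a\sim a'$; $a\sim a_1'$, $a_1'\equiv a_2'$ imply $a\sim a_2'$; and $a\sim a'$, $b\sim b'$, $a\le b$ imply $a'\le b'$. It is onto if every $a'\in A'$ has some $a$ with $a\sim a'$. Between semilattices it is a semilattice homomorphism if moreover $a\sim a'$, $b\sim b'$ imply $c\sim c'$ whenever $c\equiv a\wedge b$ and $c'\equiv a'\wedge b'$. *)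

theory Defs
  imports Main
begin

(* A preordered set is a carrier A with r satisfying "preorder_on A r"; in particular r is a
   subset of A \<times> A, so (a, b) \<in> r entails a, b \<in> A. *)

definition pre_equiv :: "'a rel \<Rightarrow> 'a \<Rightarrow> 'a \<Rightarrow> bool" where
  "pre_equiv r a b \<longleftrightarrow> (a, b) \<in> r \<and> (b, a) \<in> r"

(* Meets are determined only up to equivalence, so they are rendered as a relation:
   "is_meet r a b c" says that c is a greatest lower bound of a and b, i.e. c \<equiv> a \<and> b. *)
definition is_meet :: "'a rel \<Rightarrow> 'a \<Rightarrow> 'a \<Rightarrow> 'a \<Rightarrow> bool" where
  "is_meet r a b c \<longleftrightarrow>
     (c, a) \<in> r \<and> (c, b) \<in> r \<and> (\<forall>d. (d, a) \<in> r \<and> (d, b) \<in> r \<longrightarrow> (d, c) \<in> r)"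

definition semilattice_on :: "'a set \<Rightarrow> 'a rel \<Rightarrow> bool" where
  "semilattice_on H r \<longleftrightarrow> preorder_on H r \<and> (\<forall>a\<in>H. \<forall>b\<in>H. \<exists>c. is_meet r a b c)"

definition is_part :: "'a set \<Rightarrow> 'a rel \<Rightarrow> 'a set \<Rightarrow> 'a rel \<Rightarrow> bool" where
  "is_part M rM H rH \<longleftrightarrow> M \<subseteq> H \<and> rM = rH \<inter> (M \<times> M)"

definition semilattice_over :: "'a set \<Rightarrow> 'a rel \<Rightarrow> 'a set \<Rightarrow> 'a rel \<Rightarrow> bool" where
  "semilattice_over M rM H rH \<longleftrightarrow> semilattice_on H rH \<and> is_part M rM H rH"

definition meet_closed :: "'a rel \<Rightarrow> 'a set \<Rightarrow> bool" where
  "meet_closed r H0 \<longleftrightarrow> (\<forall>a\<in>H0. \<forall>b\<in>H0. \<forall>c. is_meet r a b c \<longrightarrow> c \<in> H0)"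

definition minimal_semilattice_over :: "'a set \<Rightarrow> 'a rel \<Rightarrow> 'a set \<Rightarrow> 'a rel \<Rightarrow> bool" where
  "minimal_semilattice_over M rM H rH \<longleftrightarrow>
     semilattice_over M rM H rH \<and> \<not> (\<exists>H0. H0 \<subset> H \<and> M \<subseteq> H0 \<and> meet_closed rH H0)"

(* "iter_meet r [a1, ..., an] c" says c \<equiv> a1 \<and> ... \<and> an for n \<ge> 1, bracketed to the left;
   there is no empty meet. *)
fun iter_meet :: "'a rel \<Rightarrow> 'a list \<Rightarrow> 'a \<Rightarrow> bool" where
  "iter_meet r [] c \<longleftrightarrow> False"
| "iter_meet r [a] c \<longleftrightarrow> pre_equiv r c a"
| "iter_meet r (a # b # as) c \<longleftrightarrow> (\<exists>d. is_meet r a b d \<and> iter_meet r (d # as) c)"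

definition free_semilattice_over :: "'a set \<Rightarrow> 'a rel \<Rightarrow> 'a set \<Rightarrow> 'a rel \<Rightarrow> bool" where
  "free_semilattice_over M rM H rH \<longleftrightarrow>
     minimal_semilattice_over M rM H rH \<and>
     (\<forall>as b c. set as \<subseteq> M \<longrightarrow> b \<in> M \<longrightarrow> iter_meet rH as c \<longrightarrow>
        ((c, b) \<in> rH \<longleftrightarrow> (\<exists>a\<in>set as. (a, b) \<in> rM)))"

definition preorder_hom ::
    "'a set \<Rightarrow> 'a rel \<Rightarrow> 'b set \<Rightarrow> 'b rel \<Rightarrow> ('a \<times> 'b) set \<Rightarrow> bool" where
  "preorder_hom A r A' r' R \<longleftrightarrow>
     R \<subseteq> A \<times> A' \<and>
     (\<forall>a\<in>A. \<exists>a'. (a, a') \<in> R) \<and>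
     (\<forall>a a1 a2. (a, a1) \<in> R \<and> pre_equiv r' a1 a2 \<longrightarrow> (a, a2) \<in> R) \<and>
     (\<forall>a b a' b'. (a, a') \<in> R \<and> (b, b') \<in> R \<and> (a, b) \<in> r \<longrightarrow> (a', b') \<in> r')"

definition hom_onto :: "'b set \<Rightarrow> ('a \<times> 'b) set \<Rightarrow> bool" where
  "hom_onto A' R \<longleftrightarrow> (\<forall>a'\<in>A'. \<exists>a. (a, a') \<in> R)"

definition semilattice_hom ::
    "'a set \<Rightarrow> 'a rel \<Rightarrow> 'b set \<Rightarrow> 'b rel \<Rightarrow> ('a \<times> 'b) set \<Rightarrow> bool" where
  "semilattice_hom A r A' r' R \<longleftrightarrow>
     preorder_hom A r A' r' R \<and>
     (\<forall>a b c a' b' c'. (a, a') \<in> R \<and> (b, b') \<in> R \<and> is_meet r a b c \<and> is_meet r' a' b' c'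
        \<longrightarrow> (c, c') \<in> R)"

lemma is_meet_iff_pre_equiv:
  assumes "preorder_on H r" and "is_meet r a b c"
  shows "is_meet r a b c' \<longleftrightarrow> pre_equiv r c' c"
  using assms unfolding is_meet_def pre_equiv_def preorder_on_def by (meson transD)

lemma iter_meet_exists:
  assumes "semilattice_on H r" and "d \<in> H" and "set ds \<subseteq> H"
  shows "\<exists>c. iter_meet r (d # ds) c"
  using assms(2,3)
proof (induction ds arbitrary: d)
  case Nil
  then show ?case
    using assms(1) by (auto simp: semilattice_on_def preorder_on_def pre_equiv_def refl_on_def)
next
  case (Cons e ds)
  then have "d \<in> H" "e \<in> H" by auto
  then obtain m where m: "is_meet r d e m"
    using assms(1) unfolding semilattice_on_def by blast
  then have "m \<in> H"
    using assms(1) unfolding semilattice_on_def preorder_on_def is_meet_def by auto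
  then obtain c where "iter_meet r (m # ds) c" using Cons.IH Cons.prems by auto
  then have "iter_meet r (d # e # ds) c" using m by auto
  then show ?case by blast
qed

lemma iter_meet_glb:
  assumes "preorder_on H r" and "iter_meet r (e # es) c"
  shows "(d, c) \<in> r \<longleftrightarrow> (\<forall>a\<in>set (e # es). (d, a) \<in> r)"
  using assms(2)
proof (induction es arbitrary: e)
  case Nil
  then show ?case
    using assms(1) by (auto simp: preorder_on_def pre_equiv_def dest: transD)
next
  case (Cons f es)
  then obtain m where m: "is_meet r e f m" "iter_meet r (m # es) c" by auto
  have "(d, m) \<in> r \<longleftrightarrow> (d, e) \<in> r \<and> (d, f) \<in> r"
    using m(1) assms(1) unfolding is_meet_def preorder_on_def by (meson transD)
  then show ?case using Cons.IH[OF m(2)] by auto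
qed

end

theory Submission
  imports Defs
begin

text \<open>By minimality every element of \<open>H\<close>, and every element of \<open>S\<close>, is the meet of a finite
  nonempty subset of \<open>M\<close>. Relate the meet in \<open>H\<close> to the meet in \<open>S\<close> of the same subset.
  If \<open>\<And>X \<le> \<And>Y\<close> in \<open>H\<close>, then by freeness each element of \<open>Y\<close> lies above some element
  of \<open>X\<close> already in \<open>M\<close>, so \<open>\<And>X \<le> \<And>Y\<close> in \<open>S\<close> as well.\<close>

definition is_glb :: "'a rel \<Rightarrow> 'a set \<Rightarrow> 'a \<Rightarrow> bool" where
  "is_glb r X c \<longleftrightarrow>
     (\<forall>a\<in>X. (c, a) \<in> r) \<and> (\<forall>d. (\<forall>a\<in>X. (d, a) \<in> r) \<longrightarrow> (d, c) \<in> r)"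

lemma is_glb_singleton:
  assumes "preorder_on H r" and "a \<in> H"
  shows "is_glb r {a} a"
  using assms by (auto simp: is_glb_def preorder_on_def refl_on_def)

lemma is_glb_pre_equiv:
  assumes "preorder_on H r" and "is_glb r X c" and "pre_equiv r c c'"
  shows "is_glb r X c'"
  using assms unfolding is_glb_def pre_equiv_def preorder_on_def by (meson transD)

lemma is_glb_Un:
  assumes "preorder_on H r" and "is_glb r X a" and "is_glb r Y b" and "is_meet r a b c"
  shows "is_glb r (X \<union> Y) c"
proof -
  have tr: "trans r" using assms(1) by (simp add: preorder_on_def)
  have "(c, x) \<in> r" if "x \<in> X \<union> Y" for x
    using that assms(2-4) tr unfolding is_glb_def is_meet_def by (meson UnE transD)
  moreover have "(d, c) \<in> r" if "\<forall>x\<in>X \<union> Y. (d, x) \<in> r" for d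
    using that assms(2-4) unfolding is_glb_def is_meet_def by blast
  ultimately show ?thesis unfolding is_glb_def by blast
qed

lemma ex_is_glb:
  assumes "semilattice_on H r" and "finite X" and "X \<noteq> {}" and "X \<subseteq> H"
  shows "\<exists>c. is_glb r X c"
  using assms(2-4)
proof (induction X rule: finite_ne_induct)
  case (singleton a)
  then show ?case using assms(1) is_glb_singleton unfolding semilattice_on_def by fastforce
next
  case (insert a X)
  have pre: "preorder_on H r" using assms(1) by (simp add: semilattice_on_def)
  obtain b where b: "is_glb r X b" using insert by auto
  \<comment> \<open>As \<open>X\<close> is nonempty, \<open>b\<close> lies below some element of it,
    which puts \<open>b\<close> in the carrier.\<close>
  have "b \<in> H"
    using b \<open>X \<noteq> {}\<close> pre unfolding is_glb_def preorder_on_def by blast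
  then obtain c where "is_meet r a b c"
    using assms(1) insert.prems unfolding semilattice_on_def by blast
  then have "is_glb r ({a} \<union> X) c"
    using is_glb_Un[OF pre is_glb_singleton[OF pre] b] insert.prems by auto
  then show ?case by auto
qed

text \<open>Bridge to the defining condition of freeness, which speaks of iterated meets of lists:
  both kinds of meet have the same lower bounds, hence are equivalent.\<close>

lemma is_glb_imp_iter_meet:
  assumes "semilattice_on H r" and "set (e # es) \<subseteq> H" and "is_glb r (set (e # es)) c"
  shows "\<exists>c'. iter_meet r (e # es) c' \<and> pre_equiv r c c'"
proof -
  have pre: "preorder_on H r" using assms(1) by (simp add: semilattice_on_def)
  obtain c' where c': "iter_meet r (e # es) c'"
    using iter_meet_exists[OF assms(1)] assms(2) by fastforce
  have le: "(c, c') \<in> r"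
    using iter_meet_glb[OF pre c'] assms(3) unfolding is_glb_def by blast
  \<comment> \<open>Reflexivity is available once \<open>le\<close> puts \<open>c'\<close> in the
    carrier; it makes \<open>c'\<close> itself a lower bound of the list.\<close>
  then have "(c', c') \<in> r"
    using pre unfolding preorder_on_def refl_on_def by blast
  then have "(c', c) \<in> r"
    using iter_meet_glb[OF pre c'] assms(3) unfolding is_glb_def by blast
  with c' le show ?thesis unfolding pre_equiv_def by blast
qed

lemma free_semilattice_glb_le_iff:
  assumes "free_semilattice_over M rM H rH"
    and "finite X" and "X \<noteq> {}" and "X \<subseteq> M" and "b \<in> M" and "is_glb rH X c"
  shows "(c, b) \<in> rH \<longleftrightarrow> (\<exists>a\<in>X. (a, b) \<in> rM)"
proof -
  have sl: "semilattice_on H rH" and "M \<subseteq> H"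
    using assms(1) unfolding free_semilattice_over_def minimal_semilattice_over_def
      semilattice_over_def is_part_def by auto
  obtain e es where X: "X = set (e # es)"
    using assms(2,3) finite_list by (metis list.exhaust set_empty)
  then obtain c' where c': "iter_meet rH (e # es) c'" "pre_equiv rH c c'"
    using is_glb_imp_iter_meet[OF sl] assms(4,6) \<open>M \<subseteq> H\<close> by blast
  have "(c, b) \<in> rH \<longleftrightarrow> (c', b) \<in> rH"
    using c'(2) sl unfolding pre_equiv_def semilattice_on_def preorder_on_def by (meson transD)
  also have "\<dots> \<longleftrightarrow> (\<exists>a\<in>X. (a, b) \<in> rM)"
    using assms(1,4,5) X c'(1) unfolding free_semilattice_over_def by blast
  finally show ?thesis .
qed

text \<open>Finite nonempty meets from \<open>M\<close> include \<open>M\<close> (singletons) and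
  are closed under meets (unions), so by minimality they cannot form a proper subset of
  \<open>H\<close>.\<close>

lemma minimal_semilattice_generated:
  assumes "minimal_semilattice_over M rM H rH" and "h \<in> H"
  shows "\<exists>X. finite X \<and> X \<noteq> {} \<and> X \<subseteq> M \<and> is_glb rH X h"
proof -
  define H0 where "H0 = {h \<in> H. \<exists>X. finite X \<and> X \<noteq> {} \<and> X \<subseteq> M \<and> is_glb rH X h}"
  have pre: "preorder_on H rH" and "M \<subseteq> H"
    using assms(1) unfolding minimal_semilattice_over_def semilattice_over_def
      semilattice_on_def is_part_def by auto
  have "m \<in> H0" if "m \<in> M" for m
    using that \<open>M \<subseteq> H\<close> is_glb_singleton[OF pre, of m] unfolding H0_def
    by (intro CollectI conjI exI[of _ "{m}"]) auto
  moreover have "c \<in> H0" if "a \<in> H0" "b \<in> H0" "is_meet rH a b c" for a b c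
  proof -
    obtain X Y where "finite X" "X \<noteq> {}" "X \<subseteq> M" "is_glb rH X a"
      and "finite Y" "Y \<subseteq> M" "is_glb rH Y b"
      using \<open>a \<in> H0\<close> \<open>b \<in> H0\<close> unfolding H0_def by blast
    moreover from this have "is_glb rH (X \<union> Y) c"
      using is_glb_Un[OF pre] that(3) by blast
    moreover have "c \<in> H"
      using that(3) pre unfolding is_meet_def preorder_on_def by blast
    ultimately show ?thesis
      unfolding H0_def by (intro CollectI conjI exI[of _ "X \<union> Y"]) auto
  qed
  ultimately have "M \<subseteq> H0" "meet_closed rH H0" unfolding meet_closed_def by blast+
  moreover have "H0 \<subseteq> H" unfolding H0_def by blast
  ultimately have "H0 = H"
    using assms(1) unfolding minimal_semilattice_over_def by blast
  with assms(2) show ?thesis unfolding H0_def by blast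
qed

theorem theorem4:
  fixes M H S :: "'a set" and rM rH rS :: "'a rel"
  assumes "preorder_on M rM"
    and "free_semilattice_over M rM H rH"
    and "minimal_semilattice_over M rM S rS"
  shows "\<exists>R. semilattice_hom H rH S rS R \<and> hom_onto S R \<and> (\<forall>a\<in>M. (a, a) \<in> R)"
proof -
  define R where "R = {(h, s). \<exists>X. finite X \<and> X \<noteq> {} \<and> X \<subseteq> M \<and> is_glb rH X h \<and> is_glb rS X s}"
  have RI: "(h, s) \<in> R"
    if "finite X" "X \<noteq> {}" "X \<subseteq> M" "is_glb rH X h" "is_glb rS X s" for X h s
    using that unfolding R_def by blast
  have RE: "\<exists>X. finite X \<and> X \<noteq> {} \<and> X \<subseteq> M \<and> is_glb rH X h \<and> is_glb rS X s"
    if "(h, s) \<in> R" for h s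
    using that unfolding R_def by blast
  have minH: "minimal_semilattice_over M rM H rH"
    using assms(2) by (simp add: free_semilattice_over_def)
  then have slH: "semilattice_on H rH" and preH: "preorder_on H rH" and "M \<subseteq> H"
    unfolding minimal_semilattice_over_def semilattice_over_def semilattice_on_def is_part_def
    by auto
  have slS: "semilattice_on S rS" and preS: "preorder_on S rS" and "M \<subseteq> S" and "rM \<subseteq> rS"
    using assms(3)
    unfolding minimal_semilattice_over_def semilattice_over_def semilattice_on_def is_part_def
    by auto
  have "trans rS" using preS by (simp add: preorder_on_def)
  have "R \<subseteq> H \<times> S"
  proof clarify
    fix h s assume "(h, s) \<in> R"
    \<comment> \<open>Any element of the nonempty \<open>X\<close> serves as
      \<open>x\<close>.\<close>
    then obtain x where "(h, x) \<in> rH" "(s, x) \<in> rS"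
      using RE unfolding is_glb_def by blast
    then show "h \<in> H \<and> s \<in> S" using preH preS unfolding preorder_on_def by blast
  qed
  \<comment> \<open>Minimality of \<open>H\<close> supplies \<open>X\<close>; its meet in
    \<open>S\<close> exists because \<open>S\<close> is a semilattice.\<close>
  moreover have "\<exists>s. (h, s) \<in> R" if "h \<in> H" for h
    using minimal_semilattice_generated[OF minH that] ex_is_glb[OF slS] RI \<open>M \<subseteq> S\<close>
    by (meson subset_trans)
  moreover have "(h, s') \<in> R" if "(h, s) \<in> R" "pre_equiv rS s s'" for h s s'
    using RE[OF that(1)] RI is_glb_pre_equiv[OF preS _ that(2)] by blast
  moreover have "(s, s') \<in> rS" if R: "(h, s) \<in> R" "(h', s') \<in> R" and le: "(h, h') \<in> rH" for h h' s s'
  proof -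
    obtain X where X: "finite X" "X \<noteq> {}" "X \<subseteq> M" "is_glb rH X h" "is_glb rS X s"
      using RE[OF R(1)] by blast
    obtain Y where Y: "Y \<subseteq> M" "is_glb rH Y h'" "is_glb rS Y s'"
      using RE[OF R(2)] by blast
    have "(s, b) \<in> rS" if "b \<in> Y" for b
    proof -
      have "(h, b) \<in> rH"
        using le Y(2) that preH unfolding is_glb_def preorder_on_def by (meson transD)
      then obtain a where "a \<in> X" "(a, b) \<in> rM"
        using free_semilattice_glb_le_iff[OF assms(2) X(1-3) _ X(4)] Y(1) \<open>b \<in> Y\<close> by blast
      then have "(s, a) \<in> rS" "(a, b) \<in> rS"
        using X(5) \<open>rM \<subseteq> rS\<close> unfolding is_glb_def by auto
      then show ?thesis using \<open>trans rS\<close> by (meson transD)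
    qed
    then show ?thesis using Y(3) unfolding is_glb_def by blast
  qed
  ultimately have "preorder_hom H rH S rS R" unfolding preorder_hom_def by blast
  moreover have "(c, c') \<in> R"
    if R: "(a, a') \<in> R" "(b, b') \<in> R" and m: "is_meet rH a b c" "is_meet rS a' b' c'"
    for a b c a' b' c'
  proof -
    obtain X where X: "finite X" "X \<noteq> {}" "X \<subseteq> M" "is_glb rH X a" "is_glb rS X a'"
      using RE[OF R(1)] by blast
    obtain Y where Y: "finite Y" "Y \<subseteq> M" "is_glb rH Y b" "is_glb rS Y b'"
      using RE[OF R(2)] by blast
    \<comment> \<open>The same union \<open>X \<union> Y\<close> represents \<open>c\<close> in
      \<open>H\<close> and \<open>c'\<close> in \<open>S\<close>.\<close>
    show ?thesis
      using X Y is_glb_Un[OF preH X(4) Y(3) m(1)] is_glb_Un[OF preS X(5) Y(4) m(2)]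
      by (intro RI[of "X \<union> Y"]) auto
  qed
  ultimately have "semilattice_hom H rH S rS R" unfolding semilattice_hom_def by blast
  \<comment> \<open>Totality with the roles exchanged: minimality of \<open>S\<close> supplies
    \<open>X\<close>, whose meet is then taken in \<open>H\<close>.\<close>
  moreover have "hom_onto S R"
    unfolding hom_onto_def
    using minimal_semilattice_generated[OF assms(3)] ex_is_glb[OF slH] RI \<open>M \<subseteq> H\<close>
    by (meson subset_trans)
  moreover have "(a, a) \<in> R" if "a \<in> M" for a
    using that \<open>M \<subseteq> H\<close> \<open>M \<subseteq> S\<close> is_glb_singleton[OF preH] is_glb_singleton[OF preS]
    by (intro RI[of "{a}"]) auto
  ultimately show ?thesis by blast
qed

end
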